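(* Let $w\in S_n$ have length $\ell$. Then in $\mathcal{K}_+$ $$\mathfrak{S}_w(u_1,u_2-u_1,u_3-u_2,\dots,u_{n-1}-u_{n-2})=\frac{1}{[\ell]_q!}\sum_{\mathbf{a}=a_1\cdots a_\ell\in\mathrm{Red}(w)}q^{\mathrm{comaj}(\mathbf{a})}\,u_{a_1}u_{a_2}\cdots u_{a_\ell}.$$
   Context: Let $\mathbf{k}$ be a field of characteristic zero and $q\in\mathbf{k}$ not a nontrivial root of unity; $[\ell]_q!=\prod_{i=1}^\ell(1+\dots+q^{i-1})$. The Klyachko algebra $\mathcal{K}$ is the commutative $\mathbf{k}$-algebra generated by $u_i$, $i\in\mathbb{Z}$, with relations $(q+1)u_i^2=qu_iu_{i-1}+u_iu_{i+1}$; $\mathcal{K}_+$ is its quotient by the ideal generated by the $u_i$, $i\le0$. $\mathfrak{S}_w$ is the Schubert polynomial: $\mathfrak{S}_{w_0}=x_1^{n-1}x_2^{n-2}\cdots x_{n-1}$ for the longest $w_0\in S_n$, and $\mathfrak{S}_{ws_i}=\partial_i\mathfrak{S}_w$ whenever $w(i)>w(i+1)$, with $\partial_i g=(g-s_ig)/(x_i-x_{i+1})$. $\mathrm{Red}(w)$ is the set of reduced words $a_1\cdots a_\ell$ with $w=s_{a_1}\cdots s_{a_\ell}$, and $\mathrm{comaj}(\mathbf{a})=\sum\{j\in[\ell-1]: a_j<a_{j+1}\}$. *)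

theory Defs
  imports "HOL-Library.Poly_Mapping" "HOL-Combinatorics.Transposition"
    "HOL-Combinatorics.Permutations"
begin

type_synonym 'k mpoly = "(nat \<Rightarrow>\<^sub>0 nat) \<Rightarrow>\<^sub>0 'k"

definition Xv :: "nat \<Rightarrow> 'k::comm_ring_1 mpoly" where
  "Xv i = Poly_Mapping.single (Poly_Mapping.single i 1) 1"

definition swap_mono :: "nat \<Rightarrow> (nat \<Rightarrow>\<^sub>0 nat) \<Rightarrow> (nat \<Rightarrow>\<^sub>0 nat)" where
  "swap_mono i m = Abs_poly_mapping (\<lambda>j. Poly_Mapping.lookup m (transpose i (Suc i) j))"

definition ssub :: "nat \<Rightarrow> 'k::comm_ring_1 mpoly \<Rightarrow> 'k mpoly" where
  "ssub i g = Abs_poly_mapping (\<lambda>m. Poly_Mapping.lookup g (swap_mono i m))"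

definition ddiff :: "nat \<Rightarrow> 'k::field mpoly \<Rightarrow> 'k mpoly" where
  "ddiff i g = (THE h. (Xv i - Xv (Suc i)) * h = g - ssub i g)"

text \<open>Evaluation of a polynomial in a commutative k-algebra A (given by the
  structure map phi : k -> A) at the point x_i := val i.\<close>
definition peval :: "('k::comm_ring_1 \<Rightarrow> 'a::comm_ring_1) \<Rightarrow> (nat \<Rightarrow> 'a) \<Rightarrow> 'k mpoly \<Rightarrow> 'a" where
  "peval phi val p = (\<Sum>m\<in>Poly_Mapping.keys p. phi (Poly_Mapping.lookup p m) * (\<Prod>i\<in>Poly_Mapping.keys m. val i ^ Poly_Mapping.lookup m i))"

text \<open>Permutations of {1..n} are functions nat => nat permuting {1..n};
  s_i is transpose i (i+1), and w s_i is w o s_i.\<close>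
definition sref :: "nat \<Rightarrow> nat \<Rightarrow> nat" where
  "sref i = transpose i (Suc i)"

definition longest :: "nat \<Rightarrow> nat \<Rightarrow> nat" where
  "longest n = (\<lambda>i. if 1 \<le> i \<and> i \<le> n then n + 1 - i else i)"

definition schub_top :: "nat \<Rightarrow> 'k::field mpoly" where
  "schub_top n = (\<Prod>i\<in>{1..<n}. Xv i ^ (n - i))"

primrec descends :: "(nat \<Rightarrow> nat) \<Rightarrow> nat list \<Rightarrow> bool" where
  "descends v [] = True"
| "descends v (c # cs) = (v c > v (Suc c) \<and> descends (v \<circ> sref c) cs)"

definition perm_after :: "(nat \<Rightarrow> nat) \<Rightarrow> nat list \<Rightarrow> (nat \<Rightarrow> nat)" where
  "perm_after v cs = fold (\<lambda>c v. v \<circ> sref c) cs v"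

text \<open>Schubert polynomial: S_{w0} = x_1^{n-1} ... x_{n-1}, and S_{w s_i} = d_i S_w
  whenever w(i) > w(i+1). Thus S_w is obtained from S_{w0} by applying
  d_{c_1}, then d_{c_2}, ..., along any descending chain
  w0, w0 s_{c_1}, w0 s_{c_1} s_{c_2}, ..., w.\<close>
definition schubert :: "nat \<Rightarrow> (nat \<Rightarrow> nat) \<Rightarrow> 'k::field mpoly" where
  "schubert n w = (SOME p. \<exists>cs. set cs \<subseteq> {1..<n} \<and> descends (longest n) cs \<and>
      perm_after (longest n) cs = w \<and> p = fold ddiff cs (schub_top n))"

definition inv_len :: "nat \<Rightarrow> (nat \<Rightarrow> nat) \<Rightarrow> nat" where
  "inv_len n w = card {(i, j). 1 \<le> i \<and> i < j \<and> j \<le> n \<and> w i > w j}"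

definition Red :: "nat \<Rightarrow> (nat \<Rightarrow> nat) \<Rightarrow> nat list set" where
  "Red n w = {a. length a = inv_len n w \<and> set a \<subseteq> {1..<n} \<and>
      foldr (\<lambda>c v. sref c \<circ> v) a id = w}"

definition comaj :: "nat list \<Rightarrow> nat" where
  "comaj a = (\<Sum>j\<in>{1..<length a}. if a ! (j - 1) < a ! j then j else 0)"

definition qfact :: "'k::comm_ring_1 \<Rightarrow> nat \<Rightarrow> 'k" where
  "qfact q l = (\<Prod>i\<in>{1..l}. \<Sum>j<i. q ^ j)"

definition ring_hom_map :: "('k::comm_ring_1 \<Rightarrow> 'a::comm_ring_1) \<Rightarrow> bool" where
  "ring_hom_map phi \<longleftrightarrow> phi 1 = 1 \<and> (\<forall>x y. phi (x + y) = phi x + phi y) \<and>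
     (\<forall>x y. phi (x * y) = phi x * phi y)"

text \<open>u : Z -> A satisfies the defining relations of K_+ (Klyachko relations
  and u_i = 0 for i <= 0).\<close>
definition klyachko_plus :: "('k::comm_ring_1 \<Rightarrow> 'a::comm_ring_1) \<Rightarrow> 'k \<Rightarrow> (int \<Rightarrow> 'a) \<Rightarrow> bool" where
  "klyachko_plus phi q u \<longleftrightarrow>
     (\<forall>i. phi (q + 1) * u i ^ 2 = phi q * u i * u (i - 1) + u i * u (i + 1)) \<and>
     (\<forall>i\<le>0. u i = 0)"

end

(*
  The proof runs in the nilCoxeter algebra with generators T_i, acting from the right on functions
  of a permutation.  With h_i(x) = 1 + x T_i, the Schubert polynomials are the coefficients of
    S(x) = C_(n-1) ... C_2 C_1,  C_k = h_k(x_1) h_(k+1)(x_2) ... h_(n-1)(x_(n-k))   (Fomin-Stanley).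
  A slightly generalised Yang-Baxter relation lets h_i(x_(i+1) - x_i) pass through the columns,
  which gives the divided difference recursion.  At x_j = u_j - u_(j-1) the same relation, combined
  with u_j (x_(j+1) - q x_j) = 0, yields
    S(q x) h_(n-1)((1-q) u_(n-1)) ... h_1((1-q) u_1) = S(x).
  By the theory of P-partitions the generating function of the right-hand sides satisfies the same
  equation, and for q different from 1 the equation determines all coefficients from the one at the
  identity.  For q = 1 the parameter q is deformed to p = 1 - eps with eps^2 = 0; both cases are
  covered by a parameter p with (1 - p)(p - q) = 0.
*)

theory Submission
  imports Defs
begin

section \<open>The nilCoxeter algebra and the Yang-Baxter relation\<close>

text \<open>A function on permutations stands for the nilCoxeter element with these coefficients;
  \<open>nil_op i\<close> is right multiplication by the \<open>i\<close>-th generator, so \<open>fold fac W\<close> is right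
  multiplication by the product of the factors \<open>1 + x T\<^sub>i\<close>, \<open>(i, x) \<in> W\<close>, read from left to right.\<close>

definition nil_op :: "nat \<Rightarrow> ((nat \<Rightarrow> nat) \<Rightarrow> 'a::comm_ring_1) \<Rightarrow> (nat \<Rightarrow> nat) \<Rightarrow> 'a" where
  "nil_op i f w = (if w (Suc i) < w i then f (w \<circ> sref i) else 0)"

definition fac :: "nat \<times> 'a \<Rightarrow> ((nat \<Rightarrow> nat) \<Rightarrow> 'a::comm_ring_1) \<Rightarrow> (nat \<Rightarrow> nat) \<Rightarrow> 'a" where
  "fac z f = (\<lambda>w. f w + snd z * nil_op (fst z) f w)"

text \<open>Equality of operators on all functions rather than of products applied to the unit, so
  that a subword may be replaced inside a longer word.\<close>

definition weq :: "(nat \<times> 'a::comm_ring_1) list \<Rightarrow> (nat \<times> 'a) list \<Rightarrow> bool" (infix "\<approx>" 50) where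
  "W \<approx> V \<longleftrightarrow> fold fac W = fold fac V"

lemma weq_refl [simp]: "W \<approx> W"
  by (simp add: weq_def)

lemma weq_trans [trans]: "W \<approx> V \<Longrightarrow> V \<approx> U \<Longrightarrow> W \<approx> U"
  by (simp add: weq_def)

lemma weq_append: "W \<approx> W' \<Longrightarrow> V \<approx> V' \<Longrightarrow> W @ V \<approx> W' @ V'"
  by (simp add: weq_def)

lemma sref_simps [simp]: "sref i i = Suc i" "sref i (Suc i) = i"
  "j \<noteq> i \<Longrightarrow> j \<noteq> Suc i \<Longrightarrow> sref i j = j"
  by (auto simp: sref_def)

lemma sref_sref [simp]: "sref i \<circ> sref i = id"
  by (simp add: sref_def)

lemma sref_braid: "sref i \<circ> sref (Suc i) \<circ> sref i = sref (Suc i) \<circ> sref i \<circ> sref (Suc i)"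
  by (auto simp: sref_def transpose_def fun_eq_iff)

lemma sref_commute: "Suc i < j \<Longrightarrow> sref i \<circ> sref j = sref j \<circ> sref i"
  by (auto simp: sref_def transpose_def fun_eq_iff)

lemma nil_op_add [simp]: "nil_op i (\<lambda>w. f w + g w) = (\<lambda>w. nil_op i f w + nil_op i g w)"
  by (auto simp: nil_op_def fun_eq_iff)

lemma nil_op_scale [simp]: "nil_op i (\<lambda>w. x * g w) = (\<lambda>w. x * nil_op i g w)"
  by (auto simp: nil_op_def fun_eq_iff)

lemma nil_op_square [simp]: "nil_op i (nil_op i f) = (\<lambda>_. 0)"
  by (auto simp: nil_op_def fun_eq_iff)

lemma nil_op_zero [simp]: "nil_op i (\<lambda>_. 0) = (\<lambda>_. 0)"
  by (auto simp: nil_op_def fun_eq_iff)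

text \<open>Both sides can be nonzero only at \<open>w\<close> with
  \<open>w (i + 2) < w (i + 1) < w i\<close>, and there the braid relation of the transpositions
  applies.\<close>

lemma nil_op_braid:
  "nil_op (Suc i) (nil_op i (nil_op (Suc i) f)) = nil_op i (nil_op (Suc i) (nil_op i f))"
  using sref_braid[of i] by (intro ext) (auto simp: nil_op_def comp_assoc)

lemma nil_op_commute:
  "Suc i < j \<Longrightarrow> nil_op j (nil_op i f) = nil_op i (nil_op j f)"
  using sref_commute[of i j] by (intro ext) (auto simp: nil_op_def comp_assoc)

lemma fac_commute: "Suc i < j \<Longrightarrow> [(i, x), (j, y)] \<approx> [(j, y), (i, x)]"
  by (auto simp: weq_def fac_def fun_eq_iff nil_op_commute algebra_simps)

lemma fac_add: "[(i, x), (i, y)] \<approx> [(i, x + y)]"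
  by (auto simp: weq_def fac_def fun_eq_iff algebra_simps)

text \<open>For \<open>y = a\<close> this is the usual Yang-Baxter equation; the two sides differ by a multiple of
  \<open>b * (a - y)\<close>.\<close>

lemma yang_baxter:
  assumes "b * y = b * a"
  shows "[(i, a), (Suc i, y + b), (i, b)] \<approx> [(Suc i, b), (i, a + b), (Suc i, y)]"
proof -
  have "fac (i, b) (fac (Suc i, y + b) (fac (i, a) f)) w -
      fac (Suc i, y) (fac (i, a + b) (fac (Suc i, b) f)) w =
      (b * a - b * y) * (nil_op (Suc i) (nil_op i f) w - nil_op i (nil_op (Suc i) f) w
        + b * nil_op i (nil_op (Suc i) (nil_op i f)) w)" for f w
    by (simp add: fac_def nil_op_braid algebra_simps)
  then show ?thesis
    using assms by (simp add: weq_def fun_eq_iff)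
qed

text \<open>Variables are indexed from 0 and generators from 1: \<open>X j\<close> is the paper's \<open>x\<^sub>j\<^sub>+\<^sub>1\<close>, and
  \<open>col m s\<close> uses the generators \<open>s + 1, \<dots>, s + m\<close>.\<close>

primrec col :: "nat \<Rightarrow> nat \<Rightarrow> (nat \<Rightarrow> 'a) \<Rightarrow> (nat \<times> 'a) list" where
  "col 0 s X = []"
| "col (Suc m) s X = (Suc s, X 0) # col m (Suc s) (\<lambda>j. X (Suc j))"

primrec schub_word :: "nat \<Rightarrow> nat \<Rightarrow> (nat \<Rightarrow> 'a) \<Rightarrow> (nat \<times> 'a) list" where
  "schub_word 0 s X = []"
| "schub_word (Suc m) s X = schub_word m (Suc s) X @ col (Suc m) s X"

section \<open>Passing a descending word through the columns\<close>

lemma col_commute: "i < s \<Longrightarrow> (i, x) # col m s X \<approx> col m s X @ [(i, x)]"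
proof (induction m arbitrary: s X)
  case 0
  then show ?case by simp
next
  case (Suc m)
  have "[(i, x), (Suc s, X 0)] @ col m (Suc s) (\<lambda>j. X (Suc j))
      \<approx> [(Suc s, X 0), (i, x)] @ col m (Suc s) (\<lambda>j. X (Suc j))"
    using Suc.prems by (intro weq_append fac_commute) auto
  also have "\<dots> = [(Suc s, X 0)] @ ((i, x) # col m (Suc s) (\<lambda>j. X (Suc j)))" by simp
  also have "\<dots> \<approx> [(Suc s, X 0)] @ (col m (Suc s) (\<lambda>j. X (Suc j)) @ [(i, x)])"
    using Suc.prems by (intro weq_append Suc.IH) auto
  finally show ?case by simp
qed

lemma col_commute': "i < s \<Longrightarrow> col m s X @ [(i, x)] \<approx> (i, x) # col m s X"
  using col_commute[of i s x m X] by (simp only: weq_def)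

lemma rev_col_commute: "i < s \<Longrightarrow> (i, x) # rev (col m s X) \<approx> rev (col m s X) @ [(i, x)]"
proof (induction m arbitrary: s X)
  case 0
  then show ?case by simp
next
  case (Suc m)
  have "((i, x) # rev (col m (Suc s) (\<lambda>j. X (Suc j)))) @ [(Suc s, X 0)]
      \<approx> (rev (col m (Suc s) (\<lambda>j. X (Suc j))) @ [(i, x)]) @ [(Suc s, X 0)]"
    using Suc.prems by (intro weq_append Suc.IH) auto
  also have "\<dots> = rev (col m (Suc s) (\<lambda>j. X (Suc j))) @ [(i, x), (Suc s, X 0)]" by simp
  also have "\<dots> \<approx> rev (col m (Suc s) (\<lambda>j. X (Suc j))) @ [(Suc s, X 0), (i, x)]"
    using Suc.prems by (intro weq_append fac_commute) auto
  finally show ?case by simp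
qed

text \<open>From the descending word, \<open>V 1\<close>, ..., \<open>V m\<close> leave on the left
  with generators raised by one, while the topmost parameter \<open>V (Suc m)\<close> is absorbed.
  The column variables turn from \<open>p * X j\<close> into \<open>X j\<close>, with a surplus
  \<open>V 0\<close> at the lowest generator.\<close>

lemma col_pass_aux:
  assumes "\<And>j. p * X j + V (Suc j) = X j + V j"
    and "\<And>j. V (Suc j) * X (Suc j) = V (Suc j) * (p * X j)"
  shows "col (Suc m) s (\<lambda>j. p * X j) @ rev (col (Suc m) s (\<lambda>j. V (Suc j)))
    \<approx> rev (col m (Suc s) (\<lambda>j. V (Suc j))) @ [(Suc s, X 0 + V 0)] @ col m (Suc s) (\<lambda>j. X (Suc j))"
  using assms
proof (induction m arbitrary: s X V)
  case 0
  then show ?case using fac_add[of "Suc s" "p * X 0" "V (Suc 0)"] by simp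
next
  case (Suc m)
  let ?h = "(Suc s, p * X 0)" and ?e = "(Suc s, V (Suc 0))"
  let ?R = "rev (col m (Suc (Suc s)) (\<lambda>j. V (Suc (Suc j))))"
  let ?C = "col m (Suc (Suc s)) (\<lambda>j. X (Suc (Suc j)))"
  let ?m = "(Suc (Suc s), X (Suc 0) + V (Suc 0))"
  have "col (Suc (Suc m)) s (\<lambda>j. p * X j) @ rev (col (Suc (Suc m)) s (\<lambda>j. V (Suc j))) =
     [?h] @ (col (Suc m) (Suc s) (\<lambda>j. p * X (Suc j)) @ rev (col (Suc m) (Suc s) (\<lambda>j. V (Suc (Suc j))))) @ [?e]"
    by (simp add: comp_def)
  also have "\<dots> \<approx> [?h] @ (?R @ [(Suc (Suc s), X (Suc 0) + V (Suc 0))] @ ?C) @ [?e]"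
    using Suc.prems by (intro weq_append Suc.IH weq_refl) auto
  also have "\<dots> = (?h # ?R) @ [?m] @ (?C @ [?e])" by simp
  also have "\<dots> \<approx> (?R @ [?h]) @ [?m] @ (?C @ [?e])"
    by (intro weq_append weq_refl rev_col_commute) auto
  also have "\<dots> \<approx> (?R @ [?h]) @ [?m] @ (?e # ?C)"
    by (intro weq_append weq_refl col_commute') auto
  also have "\<dots> = ?R @ [?h, ?m, ?e] @ ?C" by simp
  \<comment> \<open>Here \<open>a = p * X 0\<close>, \<open>y = X (Suc 0)\<close> and
    \<open>b = V (Suc 0)\<close>; the side condition is the second assumption at
    \<open>j = 0\<close>.\<close>
  also have "\<dots> \<approx> ?R @ [(Suc (Suc s), V (Suc 0)), (Suc s, p * X 0 + V (Suc 0)), (Suc (Suc s), X (Suc 0))] @ ?C"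
    using Suc.prems by (intro weq_append weq_refl yang_baxter) auto
  also have "p * X 0 + V (Suc 0) = X 0 + V 0" using Suc.prems by auto
  finally show ?case by simp
qed

text \<open>The word leaving one column is exactly the one that enters the next shorter column,
  since \<open>V 0 = 0\<close> removes the surplus. After the shortest column nothing of it is
  left.\<close>

lemma schub_word_q_shift:
  assumes "\<And>j. p * X j + V (Suc j) = X j + V j"
    and "\<And>j. V (Suc j) * X (Suc j) = V (Suc j) * (p * X j)"
    and "V 0 = 0"
  shows "schub_word m s (\<lambda>j. p * X j) @ rev (col m s (\<lambda>j. V (Suc j))) \<approx> schub_word m s X"
proof (induction m arbitrary: s)
  case 0
  then show ?case by simp
next
  case (Suc m)
  have "schub_word m (Suc s) (\<lambda>j. p * X j) @ (col (Suc m) s (\<lambda>j. p * X j) @ rev (col (Suc m) s (\<lambda>j. V (Suc j))))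
     \<approx> schub_word m (Suc s) (\<lambda>j. p * X j) @ (rev (col m (Suc s) (\<lambda>j. V (Suc j))) @ [(Suc s, X 0 + V 0)] @ col m (Suc s) (\<lambda>j. X (Suc j)))"
    by (intro weq_append weq_refl col_pass_aux assms(1,2))
  also have "\<dots> = (schub_word m (Suc s) (\<lambda>j. p * X j) @ rev (col m (Suc s) (\<lambda>j. V (Suc j)))) @ col (Suc m) s X"
    by (simp add: assms(3))
  also have "\<dots> \<approx> schub_word m (Suc s) X @ col (Suc m) s X"
    by (intro weq_append weq_refl Suc.IH)
  finally show ?case by simp
qed

section \<open>Exchanging two adjacent variables\<close>

lemma col_cong: "(\<And>j. j < m \<Longrightarrow> X j = Y j) \<Longrightarrow> col m s X = col m s Y"
proof (induction m arbitrary: s X Y)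
  case (Suc m)
  show ?case using Suc.prems Suc.IH[of "\<lambda>j. X (Suc j)" "\<lambda>j. Y (Suc j)"] by simp
qed simp

lemma transpose_Suc_Suc: "transpose (Suc j) (Suc (Suc j)) (Suc a) = Suc (transpose j (Suc j) a)"
  by (auto simp: transpose_def)

lemma transpose_Suc_zero: "transpose (Suc j) (Suc k) 0 = 0"
  by (auto simp: transpose_def)

text \<open>The column ends with the generator of the extra factor, so the two merge and the
  parameters add up to \<open>X (Suc j)\<close>.\<close>

lemma col_swap_last:
  "col (Suc j) s X @ [(s + Suc j, X (Suc j) - X j)] \<approx> col (Suc j) s (\<lambda>a. X (transpose j (Suc j) a))"
proof (induction j arbitrary: s X)
  case 0
  then show ?case using fac_add[of "Suc s" "X 0" "X (Suc 0) - X 0"] by simp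
next
  case (Suc j)
  have "[(Suc s, X 0)] @ (col (Suc j) (Suc s) (\<lambda>j. X (Suc j)) @ [(Suc s + Suc j, X (Suc (Suc j)) - X (Suc j))])
     \<approx> [(Suc s, X 0)] @ col (Suc j) (Suc s) (\<lambda>a. X (Suc (transpose j (Suc j) a)))"
    by (intro weq_append weq_refl Suc.IH)
  then show ?case by (simp add: transpose_Suc_Suc transpose_Suc_zero)
qed

text \<open>In a longer column the extra factor is not absorbed: Yang-Baxter lets it through to the
  left with its generator raised by one.\<close>

lemma col_swap:
  "Suc j < m \<Longrightarrow> col m s X @ [(s + Suc j, X (Suc j) - X j)]
    \<approx> (s + Suc (Suc j), X (Suc j) - X j) # col m s (\<lambda>a. X (transpose j (Suc j) a))"
proof (induction j arbitrary: m s X)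
  case 0
  then obtain k where m: "m = Suc (Suc k)" by (metis Suc_less_eq2 less_imp_Suc_add)
  let ?d = "X (Suc 0) - X 0"
  let ?C = "col k (Suc (Suc s)) (\<lambda>j. X (Suc (Suc j)))"
  have "col m s X @ [(Suc s, ?d)] = [(Suc s, X 0), (Suc (Suc s), X (Suc 0))] @ (?C @ [(Suc s, ?d)])"
    by (simp add: m)
  also have "\<dots> \<approx> [(Suc s, X 0), (Suc (Suc s), X (Suc 0))] @ ((Suc s, ?d) # ?C)"
    by (intro weq_append weq_refl col_commute') simp
  \<comment> \<open>Writing \<open>X (Suc 0)\<close> as \<open>X 0 + ?d\<close> gives the ordinary
    Yang-Baxter equation, with \<open>a = y = X 0\<close>.\<close>
  also have "\<dots> = [(Suc s, X 0), (Suc (Suc s), X 0 + ?d), (Suc s, ?d)] @ ?C" by simp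
  also have "\<dots> \<approx> [(Suc (Suc s), ?d), (Suc s, X 0 + ?d), (Suc (Suc s), X 0)] @ ?C"
    by (intro weq_append weq_refl yang_baxter) simp
  finally show ?case by (simp add: m transpose_def)
next
  case (Suc j)
  then obtain k where m: "m = Suc k" and k: "Suc j < k" by (metis Suc_less_eq2)
  let ?d = "X (Suc (Suc j)) - X (Suc j)"
  have "[(Suc s, X 0)] @ (col k (Suc s) (\<lambda>j. X (Suc j)) @ [(Suc s + Suc j, X (Suc (Suc j)) - X (Suc j))])
     \<approx> [(Suc s, X 0)] @ ((Suc s + Suc (Suc j), X (Suc (Suc j)) - X (Suc j)) # col k (Suc s) (\<lambda>a. X (Suc (transpose j (Suc j) a))))"
    by (intro weq_append weq_refl Suc.IH k)
  also have "\<dots> = [(Suc s, X 0), (Suc s + Suc (Suc j), ?d)] @ col k (Suc s) (\<lambda>a. X (Suc (transpose j (Suc j) a)))"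
    by simp
  also have "\<dots> \<approx> [(Suc s + Suc (Suc j), ?d), (Suc s, X 0)] @ col k (Suc s) (\<lambda>a. X (Suc (transpose j (Suc j) a)))"
    by (intro weq_append weq_refl fac_commute) simp
  finally show ?case by (simp add: m transpose_Suc_Suc transpose_Suc_zero)
qed

lemma schub_word_cong: "(\<And>j. j < m \<Longrightarrow> X j = Y j) \<Longrightarrow> schub_word m s X = schub_word m s Y"
proof (induction m arbitrary: s)
  case (Suc m)
  then have "schub_word m (Suc s) X = schub_word m (Suc s) Y" by simp
  then show ?case using col_cong[of "Suc m" X Y s] Suc.prems by simp
qed simp

text \<open>The extra factor runs left through the long columns until the column of length
  \<open>Suc j\<close> absorbs it as in \<open>col_swap_last\<close>; the shorter columns contain
  neither of the two variables.\<close>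

lemma schub_word_swap:
  "j < m \<Longrightarrow> schub_word m s X @ [(s + Suc j, X (Suc j) - X j)]
    \<approx> schub_word m s (\<lambda>a. X (transpose j (Suc j) a))"
proof (induction m arbitrary: s)
  case (Suc m)
  let ?d = "X (Suc j) - X j" and ?Y = "\<lambda>a. X (transpose j (Suc j) a)"
  show ?case
  proof (cases "j = m")
    case True
    have "schub_word m (Suc s) X = schub_word m (Suc s) ?Y"
      using True by (intro schub_word_cong) (auto simp: transpose_def)
    moreover have "schub_word m (Suc s) X @ (col (Suc m) s X @ [(s + Suc j, ?d)])
      \<approx> schub_word m (Suc s) X @ col (Suc m) s ?Y"
      using True by (intro weq_append weq_refl) (simp only: col_swap_last)
    ultimately show ?thesis by simp
  next
    case False
    then have j: "j < m" using Suc.prems by simp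
    have "schub_word m (Suc s) X @ (col (Suc m) s X @ [(s + Suc j, ?d)])
       \<approx> schub_word m (Suc s) X @ ((s + Suc (Suc j), ?d) # col (Suc m) s ?Y)"
      using j by (intro weq_append weq_refl col_swap) auto
    also have "\<dots> = (schub_word m (Suc s) X @ [(Suc s + Suc j, ?d)]) @ col (Suc m) s ?Y" by simp
    also have "\<dots> \<approx> schub_word m (Suc s) ?Y @ col (Suc m) s ?Y"
      by (intro weq_append weq_refl Suc.IH j)
    finally show ?thesis by simp
  qed
qed simp

section \<open>Inversions, reduced words and coefficients\<close>

lemma sref_permutes: "1 \<le> i \<Longrightarrow> i < n \<Longrightarrow> sref i permutes {1..n}"
  unfolding sref_def by (rule permutes_swap_id) auto

lemma comp_sref_permutes: "w permutes {1..n} \<Longrightarrow> 1 \<le> i \<Longrightarrow> i < n \<Longrightarrow> w \<circ> sref i permutes {1..n}"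
  by (intro permutes_compose sref_permutes)

lemma permutes_Suc_neq: "w permutes S \<Longrightarrow> w i \<noteq> w (Suc i)"
  by (metis n_not_Suc_n permutes_inj injD)

lemma comp_sref_sref [simp]: "w \<circ> sref i \<circ> sref i = w"
  by (simp add: comp_assoc)

lemma finite_inversions:
  fixes w :: "nat \<Rightarrow> nat"
  shows "finite {(i, j). 1 \<le> i \<and> i < j \<and> j \<le> n \<and> w i > w j}"
  by (rule finite_subset[where B = "{1..n} \<times> {1..n}"]) auto

text \<open>Applying \<open>sref i\<close> to both entries matches the inversions of
  \<open>w \<circ> sref i\<close> with those of \<open>w\<close> other than
  \<open>(i, Suc i)\<close>.\<close>

lemma inv_len_descent:
  assumes "1 \<le> i" "i < n" "w (Suc i) < w i"
  shows "inv_len n w = Suc (inv_len n (w \<circ> sref i))"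
proof -
  define I where "I v = {(a, b). 1 \<le> a \<and> a < b \<and> b \<le> n \<and> v a > (v b :: nat)}" for v
  have fin: "finite (I v)" for v unfolding I_def by (rule finite_inversions)
  have "bij_betw (\<lambda>(a, b). (sref i a, sref i b)) (I (w \<circ> sref i)) (I w - {(i, Suc i)})"
    by (rule bij_betw_byWitness[where f' = "\<lambda>(a, b). (sref i a, sref i b)"])
      (use assms in \<open>auto simp: I_def sref_def transpose_def split: if_splits\<close>)
  then have "card (I (w \<circ> sref i)) = card (I w - {(i, Suc i)})" by (rule bij_betw_same_card)
  moreover have "(i, Suc i) \<in> I w" using assms by (auto simp: I_def)
  ultimately show ?thesis
    using fin[of w] card_Suc_Diff1[of "I w" "(i, Suc i)"] by (simp add: inv_len_def I_def)
qed

lemma inv_len_ascent: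
  assumes "1 \<le> i" "i < n" "w i < w (Suc i)"
  shows "inv_len n (w \<circ> sref i) = Suc (inv_len n w)"
  using inv_len_descent[of i n "w \<circ> sref i"] assms by simp

lemma inv_len_id [simp]: "inv_len n id = 0"
proof -
  have "{(i, j). 1 \<le> i \<and> i < j \<and> j \<le> n \<and> id j < id i} = {}" by auto
  then show ?thesis by (simp only: inv_len_def card.empty)
qed

section \<open>Words and reduced words\<close>

definition word_perm :: "nat list \<Rightarrow> nat \<Rightarrow> nat" where
  "word_perm a = foldr (\<lambda>c v. sref c \<circ> v) a id"

lemma word_perm_Nil [simp]: "word_perm [] = id"
  by (simp add: word_perm_def)

lemma word_perm_Cons: "word_perm (c # a) = sref c \<circ> word_perm a"
  by (simp add: word_perm_def)

lemma word_perm_append: "word_perm (a @ b) = word_perm a \<circ> word_perm b"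
  by (induction a) (simp_all add: word_perm_Cons comp_assoc)

lemma word_perm_snoc: "word_perm (a @ [i]) = word_perm a \<circ> sref i"
  by (simp add: word_perm_append word_perm_Cons)

lemma Red_eq: "Red n w = {a. length a = inv_len n w \<and> set a \<subseteq> {1..<n} \<and> word_perm a = w}"
  by (simp add: Red_def word_perm_def)

lemma word_perm_permutes: "set a \<subseteq> {1..<n} \<Longrightarrow> word_perm a permutes {1..n}"
proof (induction a)
  case (Cons c a)
  then have "word_perm a permutes {1..n}" "sref c permutes {1..n}"
    using sref_permutes[of c n] by simp_all
  then show ?case unfolding word_perm_Cons by (rule permutes_compose)
qed (simp add: permutes_id)

lemma inv_len_word_perm: "set a \<subseteq> {1..<n} \<Longrightarrow> inv_len n (word_perm a) \<le> length a"
proof (induction a rule: rev_induct)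
  case (snoc i a)
  let ?v = "word_perm a"
  have i: "1 \<le> i" "i < n" using snoc.prems by auto
  have "?v i \<noteq> ?v (Suc i)"
    using snoc.prems by (intro permutes_Suc_neq[of _ "{1..n}"] word_perm_permutes) auto
  then have "inv_len n (?v \<circ> sref i) \<le> Suc (inv_len n ?v)"
    using inv_len_descent[OF i, of ?v] inv_len_ascent[OF i, of ?v] by linarith
  moreover have "inv_len n ?v \<le> length a" using snoc by simp
  moreover have "word_perm (a @ [i]) = ?v \<circ> sref i" by (rule word_perm_snoc)
  ultimately show ?case by (simp only: length_append_singleton)
qed simp

text \<open>If \<open>i\<close> were an ascent of \<open>w\<close>, then
  \<open>w \<circ> sref i\<close> would have more inversions than \<open>a\<close> has
  letters.\<close>

lemma word_perm_last_descent:
  assumes "set (a @ [i]) \<subseteq> {1..<n}" "word_perm (a @ [i]) = w" "inv_len n w = Suc (length a)"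
  shows "w (Suc i) < w i" "word_perm a = w \<circ> sref i" "inv_len n (w \<circ> sref i) = length a"
proof -
  have i: "1 \<le> i" "i < n" using assms by auto
  have w: "w = word_perm a \<circ> sref i" using assms(2) by (simp add: word_perm_snoc)
  then show v: "word_perm a = w \<circ> sref i" by simp
  have "inv_len n (w \<circ> sref i) \<le> length a"
    using inv_len_word_perm[of a n] assms(1) by (simp flip: v)
  moreover have "w i \<noteq> w (Suc i)"
    using assms(1) permutes_Suc_neq[OF word_perm_permutes[of "a @ [i]" n]] assms(2) by auto
  ultimately show d: "w (Suc i) < w i"
    using inv_len_ascent[OF i, of w] assms(3) by linarith
  show "inv_len n (w \<circ> sref i) = length a"
    using inv_len_descent[OF i d] assms(3) by simp
qed

lemma Red_finite: "finite (Red n w)"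
  by (rule finite_subset[OF _ finite_lists_length_eq[of "{1..<n}" "inv_len n w"]])
    (auto simp: Red_eq)

lemma Red_snoc:
  assumes "1 \<le> i" "i < n"
  shows "a @ [i] \<in> Red n w \<longleftrightarrow> w (Suc i) < w i \<and> a \<in> Red n (w \<circ> sref i)"
proof
  assume "a @ [i] \<in> Red n w"
  then show "w (Suc i) < w i \<and> a \<in> Red n (w \<circ> sref i)"
    using word_perm_last_descent[of a i n w] unfolding Red_eq by simp
next
  assume "w (Suc i) < w i \<and> a \<in> Red n (w \<circ> sref i)"
  then show "a @ [i] \<in> Red n w"
    using assms inv_len_descent[OF assms, of w] by (simp add: Red_eq word_perm_snoc)
qed

section \<open>Coefficients of a product of factors\<close>

definition at_id :: "(nat \<Rightarrow> nat) \<Rightarrow> 'a::comm_ring_1" where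
  "at_id w = (if w = id then 1 else 0)"

definition coef :: "(nat \<times> 'a::comm_ring_1) list \<Rightarrow> (nat \<Rightarrow> nat) \<Rightarrow> 'a" where
  "coef W = fold fac W at_id"

lemma coef_Nil: "coef [] = at_id"
  by (simp add: coef_def)

lemma coef_snoc: "coef (W @ [(i, x)]) w = coef W w + x * (if w (Suc i) < w i then coef W (w \<circ> sref i) else 0)"
  by (simp add: coef_def fac_def nil_op_def)

text \<open>Homogeneity: every generator that contributes raises the length by one and brings one
  parameter.\<close>

lemma coef_scale:
  assumes "fst ` set W \<subseteq> {1..<n}" "w permutes {1..n}"
  shows "coef (map (apsnd ((*) p)) W) w = p ^ inv_len n w * coef W w"
  using assms
proof (induction W arbitrary: w rule: rev_induct)
  case Nil
  then show ?case by (simp add: coef_Nil at_id_def)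
next
  case (snoc z W)
  obtain i x where z: "z = (i, x)" by (cases z)
  have i: "1 \<le> i" "i < n" using snoc.prems z by auto
  have IH: "coef (map (apsnd ((*) p)) W) v = p ^ inv_len n v * coef W v" if "v permutes {1..n}" for v
    using snoc.prems(1) by (intro snoc.IH that) auto
  note IH = IH[OF snoc.prems(2)] IH[OF comp_sref_permutes[OF snoc.prems(2) i]]
  have "coef (map (apsnd ((*) p)) (W @ [z])) w = p ^ inv_len n w * coef W w +
      p * x * (if w (Suc i) < w i then p ^ inv_len n (w \<circ> sref i) * coef W (w \<circ> sref i) else 0)"
    by (simp only: z map_append list.map apsnd_conv coef_snoc IH)
  also have "\<dots> = p ^ inv_len n w * coef (W @ [z]) w"
    using inv_len_descent[OF i, of w] by (simp add: z coef_snoc algebra_simps)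
  finally show ?case .
qed

lemma coef_eq_0:
  assumes "fst ` set W \<subseteq> {1..<n}" "w permutes {1..n}" "length W < inv_len n w"
  shows "coef W w = 0"
  using assms
proof (induction W arbitrary: w rule: rev_induct)
  case Nil
  then have "w \<noteq> id" by (metis inv_len_id not_less0)
  then show ?case by (simp only: coef_Nil at_id_def if_False)
next
  case (snoc z W)
  obtain i x where z: "z = (i, x)" by (cases z)
  have i: "1 \<le> i" "i < n" using snoc.prems z by auto
  show ?case
    using snoc comp_sref_permutes[OF snoc.prems(2) i] inv_len_descent[OF i, of w]
    by (auto simp: z coef_snoc)
qed

text \<open>The generators of \<open>W\<close> spell a reduced word, so each factor has to
  contribute its generator: with one left out, the required length is not reached.\<close>

lemma coef_word_perm:
  assumes "fst ` set W \<subseteq> {1..<n}" "inv_len n (word_perm (map fst W)) = length W"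
  shows "coef W (word_perm (map fst W)) = prod_list (map snd W)"
  using assms
proof (induction W rule: rev_induct)
  case Nil
  show ?case by (simp only: list.map word_perm_Nil coef_Nil at_id_def prod_list.Nil if_True refl)
next
  case (snoc z W)
  obtain i x where z: "z = (i, x)" by (cases z)
  define w where "w = word_perm (map fst W @ [i])"
  have s: "set (map fst W @ [i]) \<subseteq> {1..<n}" using snoc.prems z by auto
  have len: "inv_len n w = Suc (length (map fst W))" using snoc.prems(2) by (simp add: w_def z)
  note d = word_perm_last_descent[OF s w_def[symmetric] len]
  have "w permutes {1..n}" unfolding w_def using s by (rule word_perm_permutes)
  then have "coef W w = 0" using snoc.prems len by (intro coef_eq_0[of _ n]) auto
  moreover have "coef W (w \<circ> sref i) = prod_list (map snd W)"
  proof (subst d(2)[symmetric], rule snoc.IH)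
    show "inv_len n (word_perm (map fst W)) = length W"
      by (subst d(2)) (simp only: d(3) length_map)
  qed (use snoc.prems(1) in auto)
  ultimately have "coef (W @ [z]) w = prod_list (map snd (W @ [z]))"
    using d(1) by (simp add: z coef_snoc mult.commute)
  then show ?case by (simp add: w_def z)
qed

lemma coef_hom:
  assumes "\<And>x y. g (x + y) = g x + g y" "\<And>x y. g (x * y) = g x * g y" "g 1 = 1"
  shows "coef (map (apsnd g) W) w = g (coef W w)"
proof -
  have g0: "g 0 = 0" using assms(1)[of 0 0] by simp
  show ?thesis
  proof (induction W arbitrary: w rule: rev_induct)
    case Nil
    then show ?case by (simp add: coef_Nil at_id_def assms g0)
  next
    case (snoc z W)
    obtain i x where z: "z = (i, x)" by (cases z)
    show ?case
      by (simp only: z map_append list.map apsnd_conv coef_snoc snoc.IH if_distrib[of g] assms g0)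
  qed
qed

lemma coef_cong_weq: "W \<approx> V \<Longrightarrow> coef W = coef V"
  by (simp add: weq_def coef_def)

lemma map_col: "map (apsnd g) (col m s X) = col m s (\<lambda>j. g (X j))"
  by (induction m arbitrary: s X) auto

lemma map_schub_word: "map (apsnd g) (schub_word m s X) = schub_word m s (\<lambda>j. g (X j))"
  by (induction m arbitrary: s) (auto simp del: col.simps simp: map_col)

lemma fst_col: "fst ` set (col m s X) \<subseteq> {Suc s..<Suc s + m}"
  by (induction m arbitrary: s X) (auto, fastforce+)

lemma fst_schub_word: "fst ` set (schub_word m s X) \<subseteq> {Suc s..<Suc s + m}"
proof (induction m arbitrary: s)
  case (Suc m)
  show ?case using Suc[of "Suc s"] fst_col[of "Suc m" s X] by (fastforce simp del: col.simps)
qed simp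

section \<open>The coefficient at the longest permutation\<close>

lemma word_perm_col:
  "word_perm (map fst (col m s X)) =
    (\<lambda>i. if s < i \<and> i \<le> s + m then Suc i else if i = Suc (s + m) then Suc s else i)"
  by (induction m arbitrary: s X) (auto simp: fun_eq_iff sref_def transpose_def word_perm_Cons)

lemma word_perm_schub_word:
  "word_perm (map fst (schub_word m s X)) =
    (\<lambda>i. if s < i \<and> i \<le> Suc (s + m) then 2 * s + m + 2 - i else i)"
proof (induction m arbitrary: s)
  case 0
  then show ?case by (auto simp: fun_eq_iff)
next
  case (Suc m)
  show ?case
    unfolding schub_word.simps map_append word_perm_append Suc.IH word_perm_col
    by (auto simp: fun_eq_iff)
qed

lemma length_col [simp]: "length (col m s X) = m"
  by (induction m arbitrary: s X) auto

lemma length_schub_word: "length (schub_word m s X) = \<Sum>{..m}"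
  by (induction m arbitrary: s) (auto simp del: col.simps)

lemma prod_col: "prod_list (map snd (col m s X)) = (\<Prod>j<m. X j :: 'a::comm_monoid_mult)"
  by (induction m arbitrary: s X) (auto simp: prod.lessThan_Suc_shift simp del: prod.lessThan_Suc)

lemma prod_schub_word:
  "prod_list (map snd (schub_word m s X)) = (\<Prod>j<m. X j ^ (m - j) :: 'a::comm_monoid_mult)"
proof (induction m arbitrary: s)
  case (Suc m)
  have "(\<Prod>j<Suc m. X j ^ (Suc m - j)) = (\<Prod>j<Suc m. X j ^ (m - j)) * (\<Prod>j<Suc m. X j)"
    by (subst prod.distrib[symmetric], rule prod.cong) (auto simp: Suc_diff_le mult.commute)
  then show ?case using Suc by (simp only: schub_word.simps map_append prod_list.append prod_col) simp
qed simp

lemma inv_len_longest: "inv_len n (longest n) = \<Sum>{..n - 1}"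
proof -
  have "{(i, j). 1 \<le> i \<and> i < j \<and> j \<le> n \<and> longest n i > longest n j}
      = (\<lambda>(j, i). (i, j)) ` (SIGMA j:{1..n}. {1..<j})"
    by (auto simp: longest_def image_iff)
  then have "inv_len n (longest n) = card (SIGMA j:{1..n}. {1..<j})"
    unfolding inv_len_def by (simp add: card_image inj_on_def)
  also have "\<dots> = (\<Sum>j\<in>{1..n}. j - 1)" by simp
  also have "\<dots> = \<Sum>{..n - 1}"
  proof (induction n)
    case (Suc n)
    then show ?case by (cases n) simp_all
  qed simp
  finally show ?thesis .
qed

text \<open>The generators form a reduced word of \<open>longest n\<close>, so all parameters are
  multiplied; \<open>X j\<close> occurs once in each of the \<open>n - 1 - j\<close> columns longer
  than \<open>j\<close>.\<close>

lemma coef_longest: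
  "coef (schub_word (n - 1) 0 X) (longest n) = (\<Prod>j<n - 1. X j ^ (n - 1 - j))"
proof -
  have w: "word_perm (map fst (schub_word (n - 1) 0 X)) = longest n"
    unfolding word_perm_schub_word longest_def by (auto simp: fun_eq_iff)
  have "fst ` set (schub_word (n - 1) 0 X) \<subseteq> {1..<n}"
    using fst_schub_word[of "n - 1" 0 X] by (rule order.trans) auto
  note coef_word_perm[OF this, unfolded w inv_len_longest length_schub_word prod_schub_word]
  then show ?thesis by blast
qed

section \<open>Descending chains from the longest permutation\<close>

lemma descends_append: "descends v (cs @ ds) \<longleftrightarrow> descends v cs \<and> descends (perm_after v cs) ds"
  by (induction cs arbitrary: v) (auto simp: perm_after_def)

text \<open>Strict decrease gives \<open>w i \<le> n + 1 - i\<close> when counted from position 1,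
  and the reverse inequality when counted from position \<open>n\<close>.\<close>

lemma decreasing_permutes_eq_longest:
  assumes w: "w permutes {1..n}" and d: "\<And>i. 1 \<le> i \<Longrightarrow> i < n \<Longrightarrow> w (Suc i) < w i"
  shows "w = longest n"
proof
  fix i
  have up: "w (Suc k) \<le> n - k" if "k < n" for k
    using that
  proof (induction k)
    case 0
    then show ?case using permutes_in_image[OF w, of 1] by auto
  next
    case (Suc k)
    then show ?case using d[of "Suc k"] by simp
  qed
  have lo: "k < w (n - k)" if "k < n" for k
    using that
  proof (induction k)
    case 0
    then show ?case using permutes_in_image[OF w, of n] by auto
  next
    case (Suc k)
    then show ?case using d[of "n - Suc k"]
      by (simp add: Suc_diff_Suc Suc_le_eq)
  qed
  show "w i = longest n i"
  proof (cases "1 \<le> i \<and> i \<le> n")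
    case True
    then have "i - 1 < n" "n - i < n" "Suc (i - 1) = i" "n - (n - i) = i" by auto
    then have "w i \<le> n - (i - 1)" "n - i < w i" using up[of "i - 1"] lo[of "n - i"] by simp_all
    then show ?thesis using True by (simp add: longest_def)
  next
    case False
    then show ?thesis using permutes_not_in[OF w, of i] by (auto simp: longest_def)
  qed
qed

lemma inv_len_le: "inv_len n w \<le> n * n"
proof -
  have "inv_len n w \<le> card ({1..n} \<times> {1..n})"
    unfolding inv_len_def by (intro card_mono) auto
  then show ?thesis by simp
qed

lemma descending_chain_exists:
  assumes "w permutes {1..n}"
  shows "\<exists>cs. set cs \<subseteq> {1..<n} \<and> descends (longest n) cs \<and> perm_after (longest n) cs = w"
  using assms
\<comment> \<open>Climb from \<open>w\<close> along ascents; \<open>n * n\<close> is a crude bound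
  on the number of inversions.\<close>
proof (induction "n * n - inv_len n w" arbitrary: w rule: less_induct)
  case less
  show ?case
  proof (cases "w = longest n")
    case True
    then show ?thesis by (intro exI[of _ "[]"]) (simp add: perm_after_def)
  next
    case False
    then obtain i where i: "1 \<le> i" "i < n" "\<not> w (Suc i) < w i"
      using decreasing_permutes_eq_longest[OF less.prems] by blast
    then have a: "w i < w (Suc i)" using permutes_Suc_neq[OF less.prems, of i] by linarith
    have "inv_len n (w \<circ> sref i) = Suc (inv_len n w)" using i a by (intro inv_len_ascent)
    moreover have "Suc (inv_len n w) \<le> n * n"
      using inv_len_le[of n "w \<circ> sref i"] calculation by simp
    ultimately have "n * n - inv_len n (w \<circ> sref i) < n * n - inv_len n w" by linarith
    then obtain cs where "set cs \<subseteq> {1..<n}" "descends (longest n) cs"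
        "perm_after (longest n) cs = w \<circ> sref i"
      using less.hyps[of "w \<circ> sref i", OF _ comp_sref_permutes[OF less.prems i(1,2)]] by blast
    then show ?thesis using i a
      by (intro exI[of _ "cs @ [i]"]) (auto simp: descends_append perm_after_def)
  qed
qed

section \<open>Schubert polynomials\<close>

lemma poly_mapping_sum_single: "p = (\<Sum>m\<in>Poly_Mapping.keys p. Poly_Mapping.single m (Poly_Mapping.lookup p m))"
  by (rule poly_mapping_eqI) (auto simp: lookup_sum lookup_single when_def in_keys_iff)

lemma additive_sum:
  fixes g :: "'b::comm_monoid_add \<Rightarrow> 'c::ab_group_add"
  assumes "\<And>x y. g (x + y) = g x + g y"
  shows "g (sum f A) = (\<Sum>a\<in>A. g (f a))"
proof -
  have "g 0 = 0" using assms[of 0 0] by simp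
  then show ?thesis by (induction A rule: infinite_finite_induct) (auto simp: assms)
qed

text \<open>Both factors are sums of single terms, so an additive map has to be tested on terms
  only. This serves both \<open>ssub\<close> and \<open>peval\<close>.\<close>

lemma mult_hom_of_single:
  fixes g :: "'k::comm_ring_1 mpoly \<Rightarrow> 'c::comm_ring_1"
  assumes add: "\<And>x y. g (x + y) = g x + g y"
    and single: "\<And>m m' c c'. g (Poly_Mapping.single (m + m') (c * c')) =
      g (Poly_Mapping.single m c) * g (Poly_Mapping.single m' c')"
  shows "g (p * r) = g p * g r"
proof -
  let ?s = "\<lambda>p m. Poly_Mapping.single m (Poly_Mapping.lookup p m)"
  note S = additive_sum[of g, OF add]
  have "g (p * r) = g ((\<Sum>m\<in>Poly_Mapping.keys p. ?s p m) * (\<Sum>m\<in>Poly_Mapping.keys r. ?s r m))"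
    by (simp flip: poly_mapping_sum_single)
  also have "\<dots> = (\<Sum>m\<in>Poly_Mapping.keys p. g (?s p m)) * (\<Sum>m\<in>Poly_Mapping.keys r. g (?s r m))"
    by (simp add: sum_product S mult_single single)
  also have "\<dots> = g p * g r"
    by (simp flip: S poly_mapping_sum_single)
  finally show ?thesis .
qed

text \<open>The support is the preimage of a finite set under an injection, hence finite, and
  \<open>Abs_poly_mapping\<close> returns the intended function.\<close>

lemma lookup_swap_mono:
  "Poly_Mapping.lookup (swap_mono i m) j = Poly_Mapping.lookup m (transpose i (Suc i) j)"
proof -
  have "{j. Poly_Mapping.lookup m (transpose i (Suc i) j) \<noteq> 0} =
      transpose i (Suc i) -` Poly_Mapping.keys m"
    by (auto simp: in_keys_iff)
  then have "finite {j. Poly_Mapping.lookup m (transpose i (Suc i) j) \<noteq> 0}"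
    by (simp add: finite_vimageI)
  then show ?thesis by (simp add: swap_mono_def)
qed

lemma swap_mono_involutory [simp]: "swap_mono i (swap_mono i m) = m"
  by (rule poly_mapping_eqI) (simp add: lookup_swap_mono)

lemma swap_mono_add: "swap_mono i (m + m') = swap_mono i m + swap_mono i m'"
  by (rule poly_mapping_eqI) (simp add: lookup_swap_mono lookup_add)

lemma swap_mono_single: "swap_mono i (Poly_Mapping.single j c) = Poly_Mapping.single (transpose i (Suc i) j) c"
  by (rule poly_mapping_eqI) (auto simp: lookup_swap_mono lookup_single when_def)

lemma lookup_ssub: "Poly_Mapping.lookup (ssub i g) m = Poly_Mapping.lookup g (swap_mono i m)"
proof -
  have "{m. Poly_Mapping.lookup g (swap_mono i m) \<noteq> 0} = swap_mono i -` Poly_Mapping.keys g"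
    by (auto simp: in_keys_iff)
  moreover have "inj (swap_mono i)" by (metis injI swap_mono_involutory)
  ultimately have "finite {m. Poly_Mapping.lookup g (swap_mono i m) \<noteq> 0}"
    by (simp add: finite_vimageI)
  then show ?thesis by (simp add: ssub_def)
qed

lemma ssub_add: "ssub i (f + g) = ssub i f + ssub i g"
  by (rule poly_mapping_eqI) (simp add: lookup_ssub lookup_add)

lemma ssub_single: "ssub i (Poly_Mapping.single m c) = Poly_Mapping.single (swap_mono i m) c"
  by (rule poly_mapping_eqI) (auto simp: lookup_ssub lookup_single when_def)

lemma ssub_mult: "ssub i (f * g) = ssub i f * ssub i g"
  by (rule mult_hom_of_single) (simp_all add: ssub_add ssub_single swap_mono_add mult_single)

lemma ssub_one: "ssub i 1 = 1"
proof -
  have "swap_mono i 0 = 0" by (rule poly_mapping_eqI) (simp add: lookup_swap_mono)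
  then show ?thesis using ssub_single[of i 0 1] by simp
qed

lemma ssub_Xv: "ssub i (Xv j) = Xv (transpose i (Suc i) j)"
  by (simp add: Xv_def ssub_single swap_mono_single)

definition mono_eval :: "(nat \<Rightarrow> 'a::comm_ring_1) \<Rightarrow> (nat \<Rightarrow>\<^sub>0 nat) \<Rightarrow> 'a" where
  "mono_eval val m = (\<Prod>i\<in>Poly_Mapping.keys m. val i ^ Poly_Mapping.lookup m i)"

lemma mono_eval_superset:
  "finite S \<Longrightarrow> Poly_Mapping.keys m \<subseteq> S \<Longrightarrow>
    mono_eval val m = (\<Prod>i\<in>S. val i ^ Poly_Mapping.lookup m i)"
  unfolding mono_eval_def by (rule prod.mono_neutral_left) (auto simp: in_keys_iff)

lemma mono_eval_add: "mono_eval val (m + m') = mono_eval val m * mono_eval val m'"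
proof -
  let ?S = "Poly_Mapping.keys m \<union> Poly_Mapping.keys m'"
  have "mono_eval val (m + m') = (\<Prod>i\<in>?S. val i ^ Poly_Mapping.lookup (m + m') i)"
    by (rule mono_eval_superset) (use keys_add[of m m'] in auto)
  also have "\<dots> = mono_eval val m * mono_eval val m'"
    by (simp add: mono_eval_superset[of ?S] lookup_add power_add prod.distrib)
  finally show ?thesis .
qed

locale eval_hom =
  fixes phi :: "'k::comm_ring_1 \<Rightarrow> 'a::comm_ring_1" and val :: "nat \<Rightarrow> 'a"
  assumes hom: "ring_hom_map phi"
begin

lemma phi_simps: "phi 1 = 1" "phi (x + y) = phi x + phi y" "phi (x * y) = phi x * phi y"
  using hom by (auto simp: ring_hom_map_def)

lemma phi_zero: "phi 0 = 0"
  using phi_simps(2)[of 0 0] by simp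

lemma peval_superset:
  "finite S \<Longrightarrow> Poly_Mapping.keys p \<subseteq> S \<Longrightarrow>
    peval phi val p = (\<Sum>m\<in>S. phi (Poly_Mapping.lookup p m) * mono_eval val m)"
  unfolding peval_def mono_eval_def[symmetric]
  by (rule sum.mono_neutral_left) (auto simp: in_keys_iff phi_zero)

lemma peval_add: "peval phi val (p + r) = peval phi val p + peval phi val r"
proof -
  let ?S = "Poly_Mapping.keys p \<union> Poly_Mapping.keys r"
  have "peval phi val (p + r) = (\<Sum>m\<in>?S. phi (Poly_Mapping.lookup (p + r) m) * mono_eval val m)"
    by (rule peval_superset) (use keys_add[of p r] in auto)
  also have "\<dots> = peval phi val p + peval phi val r"
    by (simp add: peval_superset[of ?S] lookup_add phi_simps distrib_right sum.distrib)
  finally show ?thesis .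
qed

lemma peval_single: "peval phi val (Poly_Mapping.single m c) = phi c * mono_eval val m"
  using peval_superset[of "{m}" "Poly_Mapping.single m c"] by simp

lemma peval_mult: "peval phi val (p * r) = peval phi val p * peval phi val r"
  by (rule mult_hom_of_single)
    (simp_all add: peval_add peval_single phi_simps mono_eval_add algebra_simps)

lemma peval_one: "peval phi val 1 = 1"
  using peval_single[of 0 1] by (simp add: phi_simps mono_eval_def)

lemma peval_Xv: "peval phi val (Xv i) = val i"
  by (simp add: Xv_def peval_single phi_simps mono_eval_def)

end

section \<open>Schubert polynomials as coefficients\<close>

text \<open>Defined over any commutative ring, so that the same coefficient can be taken in the
  polynomial ring, in the algebra and over dual numbers.\<close>

definition schub_coef :: "nat \<Rightarrow> (nat \<Rightarrow> nat) \<Rightarrow> (nat \<Rightarrow> 'a::comm_ring_1) \<Rightarrow> 'a" where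
  "schub_coef n w X = coef (schub_word (n - 1) 0 X) w"

lemma schub_coef_hom:
  assumes "\<And>x y. g (x + y) = g x + g y" "\<And>x y. g (x * y) = g x * g y" "g 1 = 1"
  shows "g (schub_coef n w X) = schub_coef n w (\<lambda>j. g (X j))"
  using coef_hom[of g, OF assms] by (metis map_schub_word schub_coef_def)

text \<open>This is the coefficient at \<open>w\<close> in \<open>schub_word_swap\<close>, where the
  extra factor brings in the shorter neighbour of \<open>w\<close>.\<close>

lemma schub_coef_swap:
  assumes "j < n - 1" "w (Suc (Suc j)) < w (Suc j)"
  shows "schub_coef n w X - schub_coef n w (\<lambda>a. X (transpose j (Suc j) a)) =
    (X j - X (Suc j)) * schub_coef n (w \<circ> sref (Suc j)) X"
proof -
  have "coef (schub_word (n - 1) 0 X @ [(Suc j, X (Suc j) - X j)]) w =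
      schub_coef n w (\<lambda>a. X (transpose j (Suc j) a))"
    using coef_cong_weq[OF schub_word_swap[OF assms(1), of 0 X]] by (simp add: schub_coef_def)
  then have "schub_coef n w (\<lambda>a. X (transpose j (Suc j) a)) =
      schub_coef n w X + (X (Suc j) - X j) * schub_coef n (w \<circ> sref (Suc j)) X"
    unfolding coef_snoc using assms(2) by (simp add: schub_coef_def)
  then show ?thesis by (simp add: algebra_simps)
qed

lemma ddiff_schub_coef:
  assumes "1 \<le> i" "i < n" "w (Suc i) < w i"
  shows "ddiff i (schub_coef n w (\<lambda>j. Xv (Suc j)) :: 'k::field mpoly) =
    schub_coef n (w \<circ> sref i) (\<lambda>j. Xv (Suc j))"
proof -
  obtain k where k: "i = Suc k" "k < n - 1" using assms by (cases i) auto
  let ?P = "\<lambda>w. schub_coef n w (\<lambda>j. Xv (Suc j)) :: 'k mpoly"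
  have "ssub i (?P w) = schub_coef n w (\<lambda>j. ssub i (Xv (Suc j)))"
    by (rule schub_coef_hom) (rule ssub_add ssub_mult ssub_one)+
  also have "\<dots> = schub_coef n w (\<lambda>j. Xv (Suc (transpose k (Suc k) j)))"
    by (simp only: ssub_Xv k transpose_Suc_Suc)
  finally have eq: "(Xv i - Xv (Suc i)) * ?P (w \<circ> sref i) = ?P w - ssub i (?P w)"
    using schub_coef_swap[of k n w "\<lambda>j. Xv (Suc j) :: 'k mpoly"] k assms(3) by simp
  \<comment> \<open>Polynomials have no zero divisors, so a nonzero divisor makes the quotient
    described in \<open>ddiff\<close> unique.\<close>
  have "Xv i \<noteq> (Xv (Suc i) :: 'k mpoly)"
  proof
    assume "Xv i = (Xv (Suc i) :: 'k mpoly)"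
    then have "Poly_Mapping.keys (Xv i :: 'k mpoly) = Poly_Mapping.keys (Xv (Suc i) :: 'k mpoly)"
      by (rule arg_cong)
    then have "Poly_Mapping.single i (1 :: nat) = Poly_Mapping.single (Suc i) 1"
      by (simp add: Xv_def)
    from arg_cong[OF this, of Poly_Mapping.keys] show False by simp
  qed
  then have ne: "Xv i - Xv (Suc i) \<noteq> (0 :: 'k mpoly)" by simp
  show ?thesis unfolding ddiff_def
  proof (rule the_equality)
    fix h assume "(Xv i - Xv (Suc i)) * h = ?P w - ssub i (?P w)"
    with eq have "(Xv i - Xv (Suc i)) * h = (Xv i - Xv (Suc i)) * ?P (w \<circ> sref i)" by simp
    then show "h = ?P (w \<circ> sref i)" using ne by (simp only: mult_cancel_left) simp
  qed (rule eq)
qed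

lemma fold_ddiff_schub_coef:
  assumes "set cs \<subseteq> {1..<n}" "descends v cs"
  shows "fold ddiff cs (schub_coef n v (\<lambda>j. Xv (Suc j)) :: 'k::field mpoly) =
    schub_coef n (perm_after v cs) (\<lambda>j. Xv (Suc j))"
  using assms by (induction cs arbitrary: v) (simp_all add: ddiff_schub_coef perm_after_def)

lemma schub_top_eq: "schub_top n = (schub_coef n (longest n) (\<lambda>j. Xv (Suc j)) :: 'k::field mpoly)"
proof -
  have "schub_top n = (\<Prod>i\<in>Suc ` {..<n - 1}. Xv i ^ (n - i) :: 'k mpoly)"
    unfolding schub_top_def image_Suc_lessThan by (rule prod.cong) auto
  also have "\<dots> = (\<Prod>j<n - 1. Xv (Suc j) ^ (n - 1 - j))"
    by (subst prod.reindex) auto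
  finally show ?thesis by (simp only: schub_coef_def coef_longest)
qed

text \<open>Every descending chain from \<open>longest n\<close> to \<open>w\<close> yields this
  coefficient, and some chain exists, so the choice in \<open>schubert\<close> has a unique
  outcome.\<close>

lemma schubert_eq_schub_coef:
  assumes "w permutes {1..n}"
  shows "schubert n w = (schub_coef n w (\<lambda>j. Xv (Suc j)) :: 'k::field mpoly)"
proof -
  obtain cs where "set cs \<subseteq> {1..<n}" "descends (longest n) cs" "perm_after (longest n) cs = w"
    using descending_chain_exists[OF assms] by blast
  then show ?thesis unfolding schubert_def
    by (intro some1_equality ex_ex1I) (auto simp: schub_top_eq fold_ddiff_schub_coef)
qed

section \<open>The q-shift equation\<close>

text \<open>For \<open>q = 1\<close> and \<open>U i = i\<close> this is the side of Macdonald's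
  identity that sums over reduced words.\<close>

definition macdonald_sum :: "('k::field_char_0 \<Rightarrow> 'a::comm_ring_1) \<Rightarrow> 'k \<Rightarrow> (nat \<Rightarrow> 'a) \<Rightarrow> nat \<Rightarrow> (nat \<Rightarrow> nat) \<Rightarrow> 'a" where
  "macdonald_sum phi q U n w =
    phi (1 / qfact q (inv_len n w)) * (\<Sum>a\<in>Red n w. phi (q ^ comaj a) * prod_list (map U a))"

lemma q_int_nonzero:
  fixes q :: "'k::field_char_0"
  assumes "\<forall>m::nat. m > 0 \<and> q ^ m = 1 \<longrightarrow> q = 1" "l > 0"
  shows "(\<Sum>j<l. q ^ j) \<noteq> 0"
proof (cases "q = 1")
  case False
  then have "q ^ l \<noteq> 1" using assms by blast
  then show ?thesis using False by (simp add: geometric_sum)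
qed (use assms in simp)

lemma qfact_Suc: "qfact q (Suc l) = qfact q l * (\<Sum>j<Suc l. q ^ j)"
  by (simp add: qfact_def)

text \<open>Positions in \<open>comaj\<close> count from 1, so an ascent at the junction contributes
  \<open>length a\<close>.\<close>

lemma comaj_snoc: "comaj (a @ [i]) = comaj a + (if a \<noteq> [] \<and> last a < i then length a else 0)"
proof (cases "a = []")
  case False
  then obtain k where k: "length a = Suc k" by (metis length_0_conv old.nat.exhaust)
  have "comaj (a @ [i]) = (\<Sum>j\<in>{1..<Suc k}. if (a @ [i]) ! (j - 1) < (a @ [i]) ! j then j else 0) +
      (if (a @ [i]) ! k < (a @ [i]) ! Suc k then Suc k else 0)"
    by (simp add: comaj_def k)
  also have "(\<Sum>j\<in>{1..<Suc k}. if (a @ [i]) ! (j - 1) < (a @ [i]) ! j then j else 0) = comaj a"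
    unfolding comaj_def k by (rule sum.cong) (auto simp: nth_append k)
  also have "(a @ [i]) ! Suc k = i" using k by (metis nth_append_length)
  also have "(a @ [i]) ! k = last a" using k False by (simp add: nth_append last_conv_nth)
  finally show ?thesis using k False by simp
qed (simp add: comaj_def)

lemma macdonald_sum_hom:
  assumes g: "\<And>x y. g (x + y) = g x + g y" "\<And>x y. g (x * y) = g x * g y" "g 1 = 1"
  shows "g (macdonald_sum phi q U n w) = macdonald_sum (\<lambda>x. g (phi x)) q (\<lambda>i. g (U i)) n w"
proof -
  have "g (prod_list (map U a)) = prod_list (map (\<lambda>i. g (U i)) a)" for a
    by (induction a) (simp_all add: g)
  then show ?thesis
    by (simp add: macdonald_sum_def g additive_sum[of g, OF g(1)])
qed

text \<open>It is used with \<open>p = phi q\<close>, and for \<open>q = 1\<close> with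
  \<open>p\<close> equal to 1 minus a nilpotent. The assumption on \<open>p\<close> lets
  \<open>p\<close> replace \<open>phi q\<close> wherever a factor \<open>1 - p\<close> is
  present.\<close>

locale q_shift =
  fixes phi :: "'k::field_char_0 \<Rightarrow> 'a::comm_ring_1" and q :: 'k and U :: "nat \<Rightarrow> 'a" and p :: 'a
    and n :: nat
  assumes hom: "ring_hom_map phi"
    and q_not_root: "\<forall>m::nat. m > 0 \<and> q ^ m = 1 \<longrightarrow> q = 1"
    and p: "(1 - p) * p = (1 - p) * phi q"
    and U_0: "U 0 = 0"
    and rel: "phi (q + 1) * U (Suc j) ^ 2 = phi q * U (Suc j) * U j + U (Suc j) * U (Suc (Suc j))"
begin

lemma phi_simps: "phi 1 = 1" "phi (x + y) = phi x + phi y" "phi (x * y) = phi x * phi y"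
  using hom by (auto simp: ring_hom_map_def)

lemma p_power: "(1 - p) * p ^ k = (1 - p) * phi (q ^ k)"
proof (induction k)
  case (Suc k)
  have "(1 - p) * p ^ Suc k = (1 - p) * p * p ^ k" by simp
  also have "\<dots> = phi q * ((1 - p) * p ^ k)" by (simp add: p)
  finally show ?case by (simp add: Suc phi_simps)
qed (simp add: phi_simps)

text \<open>A geometric sum in which the powers of \<open>p\<close> become powers of
  \<open>q\<close>; the q-integer it produces cancels against the q-factorial.\<close>

lemma one_minus_p_power: "1 - p ^ l = (1 - p) * phi (\<Sum>j<l. q ^ j)"
proof (induction l)
  case 0
  show ?case using phi_simps(2)[of 0 0] by simp
next
  case (Suc l)
  have "1 - p ^ Suc l = (1 - p ^ l) + (1 - p) * p ^ l" by (simp add: algebra_simps)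
  then show ?case by (simp add: Suc p_power phi_simps distrib_left)
qed

definition weight :: "nat list \<Rightarrow> 'a" where
  "weight a = phi (q ^ comaj a) * prod_list (map U a)"

text \<open>In terms of P-partitions, a word ending in a letter below \<open>i\<close> must use the next power of
  \<open>p\<close>; this interpolates between \<open>red_sum 1\<close>, the right-hand side of the theorem, and
  \<open>red_sum n\<close>, the same sum rescaled by \<open>p\<close> in each degree.\<close>

definition red_sum :: "nat \<Rightarrow> (nat \<Rightarrow> nat) \<Rightarrow> 'a" where
  "red_sum i w = phi (1 / qfact q (inv_len n w)) *
    (\<Sum>a\<in>Red n w. weight a * (if a = [] \<or> i \<le> last a then 1 else p ^ inv_len n w))"

lemma Red_length: "a \<in> Red n w \<Longrightarrow> length a = inv_len n w"
  by (simp add: Red_def)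

lemma Red_last: "a \<in> Red n w \<Longrightarrow> a \<noteq> [] \<Longrightarrow> 1 \<le> last a \<and> last a < n"
  using subsetD[of "set a" "{1..<n}" "last a"] by (simp add: Red_def)

lemma red_sum_1: "red_sum 1 w = macdonald_sum phi q U n w"
proof -
  have "a = [] \<or> 1 \<le> last a" if "a \<in> Red n w" for a
    using Red_last[OF that] by blast
  then have "(\<Sum>a\<in>Red n w. weight a * (if a = [] \<or> 1 \<le> last a then 1 else p ^ inv_len n w)) =
      (\<Sum>a\<in>Red n w. weight a)"
    by (intro sum.cong) auto
  then show ?thesis unfolding red_sum_def macdonald_sum_def by (simp only: weight_def)
qed

text \<open>All letters are below \<open>n\<close>, so every nonempty word carries the power of
  \<open>p\<close>; for the empty word that power is 1.\<close>

lemma red_sum_n: "red_sum n w = p ^ inv_len n w * red_sum 1 w"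
proof -
  have "weight a * (if a = [] \<or> n \<le> last a then 1 else p ^ inv_len n w) =
      p ^ inv_len n w * (weight a * (if a = [] \<or> 1 \<le> last a then 1 else p ^ inv_len n w))"
    if "a \<in> Red n w" for a
  proof (cases "a = []")
    case True
    then show ?thesis using Red_length[OF that] by auto
  next
    case False
    then have "1 \<le> last a" "\<not> n \<le> last a"
      using Red_last[OF that] by auto
    then show ?thesis using False by (simp add: mult.commute)
  qed
  then show ?thesis
    by (simp add: red_sum_def sum_distrib_left mult.left_commute)
qed

text \<open>The new letter adds \<open>length b\<close> to \<open>comaj\<close> exactly if
  \<open>last b < i\<close>, and the factor \<open>1 - p\<close> turns this power of
  \<open>q\<close> into one of \<open>p\<close>.\<close>

lemma weight_snoc:
  assumes "b = [] \<or> last b \<noteq> i"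
  shows "(1 - p) * weight (b @ [i]) =
    (1 - p) * U i * (weight b * (if b = [] \<or> Suc i \<le> last b then 1 else p ^ length b))"
proof (cases "b = [] \<or> Suc i \<le> last b")
  case True
  then show ?thesis by (auto simp: weight_def comaj_snoc algebra_simps)
next
  case False
  then have "(1 - p) * weight (b @ [i]) =
      ((1 - p) * phi (q ^ length b)) * (phi (q ^ comaj b) * prod_list (map U b) * U i)"
    using assms by (simp add: weight_def comaj_snoc power_add phi_simps mult_ac)
  also have "\<dots> = ((1 - p) * p ^ length b) * (phi (q ^ comaj b) * prod_list (map U b) * U i)"
    by (simp only: p_power)
  finally show ?thesis using False by (simp add: weight_def mult_ac)
qed

text \<open>The two sums differ only in the words ending in \<open>i\<close>. Deleting that letter
  leaves reduced words of \<open>w \<circ> sref i\<close>, and \<open>1 - p ^ l\<close> over the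
  q-factorial of \<open>l\<close> becomes \<open>1 - p\<close> over that of
  \<open>l - 1\<close>.\<close>

lemma red_sum_step:
  assumes i: "1 \<le> i" "i < n"
  shows "red_sum i w = fac (i, (1 - p) * U i) (red_sum (Suc i)) w"
proof -
  let ?l = "inv_len n w" and ?v = "w \<circ> sref i"
  let ?c = "\<lambda>i w a. if a = [] \<or> i \<le> last a then 1 else p ^ inv_len n w"
  let ?R = "{a \<in> Red n w. a \<noteq> [] \<and> last a = i}"
  have "(\<Sum>a\<in>Red n w. weight a * ?c i w a) - (\<Sum>a\<in>Red n w. weight a * ?c (Suc i) w a) =
      (\<Sum>a\<in>Red n w. if a \<noteq> [] \<and> last a = i then weight a * (1 - p ^ ?l) else 0)"
    by (subst sum_subtractf[symmetric], rule sum.cong) (auto simp: algebra_simps)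
  also have "\<dots> = (\<Sum>a\<in>?R. weight a * (1 - p ^ ?l))"
    by (simp add: sum.inter_filter Red_finite)
  finally have diff: "red_sum i w - red_sum (Suc i) w =
      phi (1 / qfact q ?l) * (\<Sum>a\<in>?R. weight a * (1 - p ^ ?l))"
    by (simp add: red_sum_def flip: right_diff_distrib)
  have R: "a \<in> ?R \<longleftrightarrow> (\<exists>b. a = b @ [i] \<and> w (Suc i) < w i \<and> b \<in> Red n ?v)" for a
    by (cases a rule: rev_cases) (auto simp: Red_snoc[OF i])
  show ?thesis
  proof (cases "w (Suc i) < w i")
    case False
    then have "?R = {}" using R by blast
    then show ?thesis using diff False by (simp only: sum.empty fac_def nil_op_def fst_conv snd_conv) simp
  next
    case True
    then have l: "?l = Suc (inv_len n ?v)" by (rule inv_len_descent[OF i])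
    \<comment> \<open>The letter \<open>i\<close> is an ascent of \<open>w \<circ> sref i\<close>,
      so no reduced word of it ends in \<open>i\<close>.\<close>
    have last: "b = [] \<or> last b \<noteq> i" if "b \<in> Red n ?v" for b
    proof (rule ccontr)
      assume "\<not> ?thesis"
      then have "butlast b @ [i] \<in> Red n ?v"
        using that by (metis append_butlast_last_id)
      then show False using Red_snoc[OF i, of "butlast b" ?v] True by simp
    qed
    have summand: "weight (b @ [i]) * (1 - p ^ ?l) =
        phi (\<Sum>j<?l. q ^ j) * ((1 - p) * U i * (weight b * ?c (Suc i) ?v b))"
      if "b \<in> Red n ?v" for b
    proof -
      have "weight (b @ [i]) * (1 - p ^ ?l) = phi (\<Sum>j<?l. q ^ j) * ((1 - p) * weight (b @ [i]))"
        by (simp only: one_minus_p_power mult_ac)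
      then show ?thesis
        by (simp only: weight_snoc[OF last[OF that]] Red_length[OF that])
    qed
    have nz: "(\<Sum>j<?l. q ^ j) \<noteq> 0"
      by (rule q_int_nonzero[OF q_not_root]) (simp only: l zero_less_Suc)
    have "?R = (\<lambda>b. b @ [i]) ` Red n ?v" using R True by blast
    then have "(\<Sum>a\<in>?R. weight a * (1 - p ^ ?l)) = (\<Sum>b\<in>Red n ?v. weight (b @ [i]) * (1 - p ^ ?l))"
      by (simp add: sum.reindex inj_on_def)
    also have "\<dots> = (\<Sum>b\<in>Red n ?v. phi (\<Sum>j<?l. q ^ j) * ((1 - p) * U i * (weight b * ?c (Suc i) ?v b)))"
      by (rule sum.cong[OF refl]) (rule summand)
    also have "\<dots> = phi (\<Sum>j<?l. q ^ j) * ((1 - p) * U i * (\<Sum>b\<in>Red n ?v. weight b * ?c (Suc i) ?v b))"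
      by (simp only: sum_distrib_left)
    finally have "red_sum i w - red_sum (Suc i) w =
        phi (1 / qfact q ?l * (\<Sum>j<?l. q ^ j)) * ((1 - p) * U i * (\<Sum>b\<in>Red n ?v. weight b * ?c (Suc i) ?v b))"
      unfolding diff by (simp only: phi_simps mult.assoc)
    also have "1 / qfact q ?l * (\<Sum>j<?l. q ^ j) = 1 / qfact q (inv_len n ?v)"
      using nz unfolding l qfact_Suc by (simp del: sum.lessThan_Suc)
    finally have "red_sum i w - red_sum (Suc i) w = (1 - p) * U i * red_sum (Suc i) ?v"
      by (simp only: red_sum_def mult_ac)
    then show ?thesis using True
      by (simp only: fac_def nil_op_def fst_conv snd_conv if_True) (simp add: algebra_simps)
  qed
qed

lemma rev_col: "rev (col m s V) = map (\<lambda>i. (i, V (i - Suc s))) (rev [Suc s..<Suc s + m])"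
proof (induction m arbitrary: s V)
  case (Suc m)
  have "[Suc s..<Suc s + Suc m] = Suc s # [Suc (Suc s)..<Suc (Suc s) + m]"
    by (simp add: upt_conv_Cons del: upt_Suc)
  moreover have "map (\<lambda>i. (i, V (Suc (i - Suc (Suc s))))) (rev [Suc (Suc s)..<Suc (Suc s) + m]) =
      map (\<lambda>i. (i, V (i - Suc s))) (rev [Suc (Suc s)..<Suc (Suc s) + m])"
    by (rule map_cong) (auto simp: Suc_diff_Suc simp del: upt_Suc)
  ultimately show ?case by (simp add: Suc del: upt_Suc)
qed simp

abbreviation "shift_word \<equiv> map (\<lambda>i. (i, (1 - p) * U i)) (rev [1..<n])"

lemma red_sum_shift:
  "red_sum 1 = fold fac shift_word (red_sum n)"
proof (cases "n = 0")
  case False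
  have "k < n \<Longrightarrow> red_sum (n - k) = fold fac (map (\<lambda>i. (i, (1 - p) * U i)) (rev [n - k..<n])) (red_sum n)" for k
  proof (induction k)
    case (Suc k)
    then have e: "[n - Suc k..<n] = (n - Suc k) # [n - k..<n]" "Suc (n - Suc k) = n - k"
      by (simp_all add: upt_conv_Cons Suc_diff_Suc)
    have "red_sum (n - Suc k) = fac (n - Suc k, (1 - p) * U (n - Suc k)) (red_sum (n - k))"
      using red_sum_step[of "n - Suc k"] Suc.prems e(2) by (intro ext) simp
    with Suc e show ?case by simp
  qed simp
  from this[of "n - 1"] show ?thesis using False by simp
next
  case True
  \<comment> \<open>For \<open>n = 0\<close> the index 1 lies above \<open>n\<close>; the sums agree
    because only the empty word can occur.\<close>
  have "red_sum 1 = red_sum 0"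
  proof
    fix w
    have "a = []" if "a \<in> Red n w" for a
      using Red_last[OF that] True by auto
    then show "red_sum 1 w = red_sum 0 w"
      unfolding red_sum_def by (intro arg_cong2[where f = "(*)"] sum.cong refl) auto
  qed
  then show ?thesis using True by simp
qed

abbreviation "X \<equiv> \<lambda>j. U (Suc j) - U j"

text \<open>This is \<open>schub_word_q_shift\<close> with \<open>V j = (1 - p) * U j\<close>, for
  which the two hypotheses on \<open>X\<close> and \<open>V\<close> become a telescoping identity
  and the Klyachko relation.\<close>

lemma schub_coef_shift:
  "schub_coef n w X = fold fac shift_word (coef (schub_word (n - 1) 0 (\<lambda>j. p * X j))) w"
proof -
  define V where "V j = (1 - p) * U j" for j
  have "schub_word (n - 1) 0 (\<lambda>j. p * X j) @ rev (col (n - 1) 0 (\<lambda>j. V (Suc j))) \<approx> schub_word (n - 1) 0 X"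
  proof (rule schub_word_q_shift)
    fix j
    show "p * X j + V (Suc j) = X j + V j" by (simp add: V_def algebra_simps)
    have "V (Suc j) * X (Suc j) - V (Suc j) * (p * X j) =
        (1 - p) * (U (Suc j) * U (Suc (Suc j)) - U (Suc j) ^ 2) - ((1 - p) * p) * (U (Suc j) * X j)"
      by (simp add: V_def algebra_simps power2_eq_square)
    \<comment> \<open>The factor \<open>1 - p\<close> turns the remaining \<open>p\<close> into
      \<open>phi q\<close>, which makes the relation applicable.\<close>
    also have "\<dots> = (1 - p) * (phi q * U (Suc j) * U j + U (Suc j) * U (Suc (Suc j)) - phi (q + 1) * U (Suc j) ^ 2)"
      unfolding p by (simp add: phi_simps algebra_simps power2_eq_square)
    also have "\<dots> = 0" by (simp add: rel)
    finally show "V (Suc j) * X (Suc j) = V (Suc j) * (p * X j)" by simp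
  qed (simp add: V_def U_0)
  moreover have "rev (col (n - 1) 0 (\<lambda>j. V (Suc j))) = shift_word"
    unfolding rev_col by (cases n) (auto simp: V_def rev_map[symmetric])
  ultimately have "coef (schub_word (n - 1) 0 X) = coef (schub_word (n - 1) 0 (\<lambda>j. p * X j) @ shift_word)"
    using coef_cong_weq by metis
  then show ?thesis by (simp only: schub_coef_def coef_def fold_append comp_apply)
qed

text \<open>Each factor corrects the difference at \<open>v\<close> by a multiple of
  \<open>1 - p\<close> times the difference at a shorter permutation, and such products vanish by
  assumption.\<close>

lemma fold_fac_diff:
  assumes "\<And>i x. (i, x) \<in> set W \<Longrightarrow> 1 \<le> i \<and> i < n \<and> (1 - p) dvd x"
    and "\<And>v. v permutes {1..n} \<Longrightarrow> inv_len n v < L \<Longrightarrow> (1 - p) * (f v - g v) = 0"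
    and "v permutes {1..n}" "inv_len n v \<le> L"
  shows "fold fac W f v - fold fac W g v = f v - g v"
  using assms
proof (induction W arbitrary: f g v)
  case (Cons z W)
  obtain i x where z: "z = (i, x)" by (cases z)
  have i: "1 \<le> i" "i < n" and "(1 - p) dvd x" using Cons.prems(1)[of i x] z by auto
  then obtain c where x: "x = (1 - p) * c" by (auto elim: dvdE)
  have one: "fac z f v - fac z g v = f v - g v" if "v permutes {1..n}" "inv_len n v \<le> L" for v
  proof -
    have "fac z f v - fac z g v = f v - g v +
        (if v (Suc i) < v i then c * ((1 - p) * (f (v \<circ> sref i) - g (v \<circ> sref i))) else 0)"
      by (simp add: z x fac_def nil_op_def algebra_simps)
    also have "\<dots> = f v - g v"
    proof (cases "v (Suc i) < v i")
      case True
      then have "inv_len n (v \<circ> sref i) < L" using inv_len_descent[OF i True] that(2) by simp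
      from Cons.prems(2)[OF comp_sref_permutes[OF that(1) i] this] show ?thesis by (simp only: mult_zero_right) simp
    qed simp
    finally show ?thesis .
  qed
  have "fold fac W (fac z f) v - fold fac W (fac z g) v = fac z f v - fac z g v"
  proof (rule Cons.IH)
    show "(1 - p) * (fac z f v - fac z g v) = 0" if "v permutes {1..n}" "inv_len n v < L" for v
      using one[OF that(1)] Cons.prems(2)[OF that] that(2) by simp
  qed (use Cons.prems in auto)
  then show ?case using one Cons.prems by simp
qed simp

lemma coef_no_inversion:
  assumes "inv_len n w = 0" "fst ` set W \<subseteq> {1..<n}"
  shows "coef W w = at_id w"
  using assms(2)
proof (induction W rule: rev_induct)
  case (snoc z W)
  obtain i x where z: "z = (i, x)" by (cases z)
  have "\<not> w (Suc i) < w i" using inv_len_descent[of i n w] assms(1) snoc.prems z by auto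
  then show ?case using snoc z by (simp add: coef_snoc)
qed (simp add: coef_Nil)

lemma fst_schub_word_n: "fst ` set (schub_word (n - 1) 0 Y) \<subseteq> {1..<n}"
  using fst_schub_word[of "n - 1" 0 Y] by (rule order.trans) auto

text \<open>By induction on the length, the common shift equation gives \<open>d = p ^ l * d\<close>
  for the difference \<open>d\<close>, so the q-integer of \<open>l\<close> times
  \<open>(1 - p) * d\<close> vanishes. The factor \<open>1 - p\<close> stays, since it may be
  nilpotent.\<close>

lemma schub_coef_macdonald:
  assumes "w permutes {1..n}"
  shows "(1 - p) * (schub_coef n w X - macdonald_sum phi q U n w) = 0"
  using assms
proof (induction "inv_len n w" arbitrary: w rule: less_induct)
  case less
  let ?L = "inv_len n w"
  let ?d = "\<lambda>v. schub_coef n v X - red_sum 1 v"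
  let ?f = "coef (schub_word (n - 1) 0 (\<lambda>j. p * X j))"
  have scale: "?f v - red_sum n v = p ^ inv_len n v * ?d v" if "v permutes {1..n}" for v
    using coef_scale[OF fst_schub_word_n[of X] that, of p]
    by (simp only: map_schub_word red_sum_n schub_coef_def right_diff_distrib)
  have "?d w = fold fac shift_word ?f w - fold fac shift_word (red_sum n) w"
    by (subst schub_coef_shift, subst red_sum_shift) (rule refl)
  also have "\<dots> = ?f w - red_sum n w"
  proof (rule fold_fac_diff[where L = ?L])
    show "(1 - p) * (?f v - red_sum n v) = 0" if v: "v permutes {1..n}" "inv_len n v < ?L" for v
    proof -
      have "(1 - p) * (?f v - red_sum n v) = p ^ inv_len n v * ((1 - p) * ?d v)"
        by (simp only: scale[OF v(1)] mult_ac)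
      also have "(1 - p) * ?d v = 0" unfolding red_sum_1 by (rule less.hyps[OF v(2,1)])
      finally show ?thesis by simp
    qed
  qed (use less.prems in auto)
  also have "\<dots> = p ^ ?L * ?d w" by (rule scale[OF less.prems])
  finally have "(1 - p ^ ?L) * ?d w = 0" by (simp add: algebra_simps)
  then have eq: "phi (\<Sum>j<?L. q ^ j) * ((1 - p) * ?d w) = 0"
    by (simp only: one_minus_p_power mult_ac)
  show ?case
  \<comment> \<open>In length 0 the q-integer is 0 and the equation is void, so both sides are
    computed; otherwise it is invertible.\<close>
  proof (cases "?L = 0")
    case True
    have "Red n w = (if w = id then {[]} else {})"
      using True by (auto simp: Red_eq)
    then have "macdonald_sum phi q U n w = at_id w"
      using True by (simp add: macdonald_sum_def at_id_def qfact_def phi_simps comaj_def)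
    moreover have "schub_coef n w X = at_id w"
      unfolding schub_coef_def by (rule coef_no_inversion[OF True fst_schub_word_n])
    ultimately show ?thesis by simp
  next
    case False
    let ?q = "\<Sum>j<?L. q ^ j"
    have "?q \<noteq> 0" using False by (intro q_int_nonzero[OF q_not_root]) simp
    then have "phi (1 / ?q * ?q) = 1" by (simp add: phi_simps(1))
    then have inv: "phi (1 / ?q) * phi ?q = 1" by (simp only: phi_simps(3))
    have "(1 - p) * ?d w = phi (1 / ?q) * (phi ?q * ((1 - p) * ?d w))"
      by (simp only: mult.assoc[symmetric, of "phi (1 / ?q)"] inv mult_1)
    also have "\<dots> = 0" by (simp only: eq mult_zero_right)
    finally show ?thesis unfolding red_sum_1 .
  qed
qed

end

section \<open>Dual numbers, and the conclusion for \<open>q\<close> different from or equal to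
  1\<close>

datatype 'a dual = Dual (dual_re: 'a) (dual_eps: 'a)

instantiation dual :: (comm_ring_1) comm_ring_1
begin

definition "0 = Dual 0 0"
definition "1 = Dual 1 0"
definition "x + y = Dual (dual_re x + dual_re y) (dual_eps x + dual_eps y)"
definition "x - y = Dual (dual_re x - dual_re y) (dual_eps x - dual_eps y)"
definition "- x = Dual (- dual_re x) (- dual_eps x)"
definition "x * y = Dual (dual_re x * dual_re y) (dual_re x * dual_eps y + dual_eps x * dual_re y)"

instance
  by standard
    (auto simp: zero_dual_def one_dual_def plus_dual_def minus_dual_def uminus_dual_def times_dual_def
      algebra_simps intro: dual.expand)

end

lemmas dual_defs = zero_dual_def one_dual_def plus_dual_def minus_dual_def times_dual_def

theorem theorem1p4:
  fixes q :: "'k::field_char_0" and n :: nat and w :: "nat \<Rightarrow> nat"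
    and phi :: "'k \<Rightarrow> 'a::comm_ring_1" and u :: "int \<Rightarrow> 'a"
  assumes q_not_root: "\<forall>m::nat. m > 0 \<and> q ^ m = 1 \<longrightarrow> q = 1"
    and w_perm: "w permutes {1..n}"
    and alg: "ring_hom_map phi"
    and rel: "klyachko_plus phi q u"
  shows "peval phi (\<lambda>i. if i = 1 then u 1 else u (int i) - u (int i - 1)) (schubert n w) =
    phi (1 / qfact q (inv_len n w)) *
      (\<Sum>a\<in>Red n w. phi (q ^ comaj a) * (\<Prod>j<length a. u (int (a ! j))))"
proof -
  let ?val = "\<lambda>i::nat. if i = 1 then u 1 else u (int i) - u (int i - 1)"
  define U where "U j = u (int j)" for j
  interpret E: eval_hom phi ?val by standard (rule alg)
  have U0: "U 0 = 0" using rel by (simp add: U_def klyachko_plus_def)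
  have Urel: "phi (q + 1) * U (Suc j) ^ 2 = phi q * U (Suc j) * U j + U (Suc j) * U (Suc (Suc j))" for j
  proof -
    have "phi (q + 1) * u (int (Suc j)) ^ 2 =
        phi q * u (int (Suc j)) * u (int (Suc j) - 1) + u (int (Suc j)) * u (int (Suc j) + 1)"
      using rel unfolding klyachko_plus_def by blast
    moreover have "int (Suc j) - 1 = int j" "int (Suc j) + 1 = int (Suc (Suc j))" by simp_all
    ultimately show ?thesis unfolding U_def by (simp only:)
  qed
  let ?X = "\<lambda>j. U (Suc j) - U j"
  \<comment> \<open>The separate value at 1 fits the general form because
    \<open>U 0 = 0\<close>.\<close>
  have val: "?val (Suc j) = ?X j" for j
    using U0 by (simp add: U_def)
  have "peval phi ?val (schubert n w) = schub_coef n w (\<lambda>j. peval phi ?val (Xv (Suc j)))"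
    unfolding schubert_eq_schub_coef[OF w_perm]
    by (rule schub_coef_hom) (rule E.peval_add E.peval_mult E.peval_one)+
  also have "\<dots> = schub_coef n w ?X" by (simp only: E.peval_Xv val)
  also have "schub_coef n w ?X = macdonald_sum phi q U n w"
  proof (cases "q = 1")
    case False
    interpret S: q_shift phi q U "phi q" n
      by standard (use alg q_not_root U0 Urel in simp_all)
    have "phi 1 = phi (1 - q) + phi q" by (simp flip: E.phi_simps(2))
    \<comment> \<open>The remaining factor is the image of a unit of the field and can be
      cancelled.\<close>
    then have "1 - phi q = phi (1 - q)" by (metis add_diff_cancel_right' E.phi_simps(1))
    then have "phi (1 - q) * (schub_coef n w ?X - macdonald_sum phi q U n w) = 0"
      using S.schub_coef_macdonald[OF w_perm] by (simp only:)
    then have "phi (1 / (1 - q) * (1 - q)) * (schub_coef n w ?X - macdonald_sum phi q U n w) = 0"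
      by (simp only: E.phi_simps mult.assoc mult_zero_right)
    then show ?thesis using False by (simp add: E.phi_simps)
  next
    case True
    define em where "em x = Dual x 0" for x :: 'a
    have em: "em (x + y) = em x + em y" "em (x * y) = em x * em y" "em 1 = 1" "em 0 = 0"
        "em (x - y) = em x - em y" for x y
      by (simp_all add: em_def dual_defs)
    \<comment> \<open>\<open>Dual 1 (- 1)\<close> is \<open>1 - eps\<close>, so
      \<open>1 - p = eps\<close> and \<open>(1 - p) * p = eps\<close>, as required for
      \<open>q = 1\<close>.\<close>
    interpret S: q_shift "\<lambda>x. em (phi x)" q "\<lambda>j. em (U j)" "Dual 1 (- 1)" n
    proof
      show "ring_hom_map (\<lambda>x. em (phi x))"
        unfolding ring_hom_map_def by (simp add: em E.phi_simps)
      show "(1 - Dual 1 (- 1)) * Dual 1 (- 1) = (1 - Dual 1 (- 1)) * em (phi q)"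
        by (simp add: True E.phi_simps em_def dual_defs)
      show "em (phi (q + 1)) * em (U (Suc j)) ^ 2 =
          em (phi q) * em (U (Suc j)) * em (U j) + em (U (Suc j)) * em (U (Suc (Suc j)))" for j
        using arg_cong[OF Urel[of j], of em] by (simp only: em power2_eq_square)
    qed (use q_not_root in \<open>simp_all add: U0 em\<close>)
    have "(1 - Dual 1 (- 1)) * em (schub_coef n w ?X - macdonald_sum phi q U n w) = 0"
      using S.schub_coef_macdonald[OF w_perm]
      by (simp only: em schub_coef_hom[of em, OF em(1-3)] macdonald_sum_hom[of em, OF em(1-3)])
    \<comment> \<open>Multiplication by \<open>eps\<close> moves an embedded element to the second
      component, where it must vanish.\<close>
    then show ?thesis by (simp add: em_def dual_defs)
  qed
  also have "\<dots> = phi (1 / qfact q (inv_len n w)) *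
      (\<Sum>a\<in>Red n w. phi (q ^ comaj a) * (\<Prod>j<length a. u (int (a ! j))))"
    by (simp add: macdonald_sum_def U_def prod.list_conv_set_nth atLeast0LessThan)
  finally show ?thesis .
qed

end
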